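(* Let $N$ be a positive integer and let $\alpha=\log_{10}2$. Then the Benford errors $E_d(N)=E_d(N,\{2^n\})$ of the sequence $\{2^n\}$ satisfy $$E_1(N)=-\{N\alpha\},$$ $$E_4(N)=\{N\alpha\}+\{N\alpha-\alpha\}+\{N\alpha+\alpha\}-1,$$ where $\{x\}$ denotes the fractional part of a real number $x$.
   Context: For a real number $x>0$, $D(x)\in\{1,\dots,9\}$ denotes the leading (most significant) decimal digit of $x$, ignoring leading zeros. The fractional part is $\{x\}=x-\lfloor x\rfloor$. For $d\in\{1,\dots,9\}$ and a positive integer $N$, the Benford error of the sequence $\{2^n\}_{n\ge1}$ is $$E_d(N)=E_d(N,\{2^n\})=\#\{n\in\{1,\dots,N\}: D(2^n)=d\}-N\log_{10}\left(1+\tfrac1d\right).$$ *)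

theory Defs
  imports Complex_Main
begin

text \<open>The decimal digit of a positive real at the place with weight \<open>10\<^sup>k\<close>.\<close>
definition decimal_digit :: "real \<Rightarrow> int \<Rightarrow> nat" where
  "decimal_digit x k = nat (\<lfloor>x / 10 powi k\<rfloor> mod 10)"

text \<open>Meaningful for \<open>x > 0\<close>, where the greatest place with a nonzero digit exists.\<close>
definition leading_digit :: "real \<Rightarrow> nat" where
  "leading_digit x = decimal_digit x (GREATEST k. decimal_digit x k \<noteq> 0)"

definition benford_error :: "nat \<Rightarrow> nat \<Rightarrow> (nat \<Rightarrow> real) \<Rightarrow> real" where
  "benford_error d N a =
     real (card {n \<in> {1..N}. leading_digit (a n) = d}) - real N * log 10 (1 + 1 / real d)"

lemma leading_digit_eqI:
  fixes x :: real and d :: nat and k :: int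
  assumes d: "1 \<le> d" "d \<le> 9"
    and x: "real d * 10 powi k \<le> x" "x < (real d + 1) * 10 powi k"
  shows "leading_digit x = d"
proof -
  have p: "(10::real) powi k > 0" by simp
  have "\<lfloor>x / 10 powi k\<rfloor> = int d"
    using x p by (intro floor_unique) (simp_all add: pos_le_divide_eq pos_divide_less_eq)
  then have dk: "decimal_digit x k = d"
    using d by (simp add: decimal_digit_def)
  have "0 \<le> real d * 10 powi k" by simp
  then have xpos: "x \<ge> 0" using x(1) by (rule order_trans)
  have zero: "decimal_digit x j = 0" if "k < j" for j
  proof -
    have "(real d + 1) * 10 powi k \<le> 10 * 10 powi k"
      using d(2) by (intro mult_right_mono) auto
    with x(2) have "x < 10 * 10 powi k" by (rule less_le_trans)
    also have "\<dots> = 10 powi (k + 1)" by (simp add: power_int_add)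
    also have "\<dots> \<le> 10 powi j" using that by (intro power_int_increasing) auto
    finally have "x / 10 powi j < 1" by simp
    moreover have "x / 10 powi j \<ge> 0" using xpos by simp
    ultimately have "\<lfloor>x / 10 powi j\<rfloor> = 0" by linarith
    then show ?thesis by (simp add: decimal_digit_def)
  qed
  have "(GREATEST k. decimal_digit x k \<noteq> 0) = k"
  proof (rule Greatest_equality)
    show "decimal_digit x k \<noteq> 0" using dk d by simp
    show "j \<le> k" if "decimal_digit x j \<noteq> 0" for j
      using zero[of j] that by (cases "k < j") auto
  qed
  then show ?thesis using dk by (simp add: leading_digit_def)
qed

end

theory Submission
  imports Defs
begin

text \<open>Write \<open>\<alpha> = log 10 2\<close>. A number \<open>x > 0\<close> has leading digit \<open>d\<close> exactly when the fractional part
  of \<open>log 10 x\<close> lies in the interval from \<open>log 10 d\<close> (included) to \<open>log 10 (d + 1)\<close> (excluded), and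
  membership of a fractional part in an interval is a difference of two floors. Hence the number of
  \<open>n \<le> N\<close> for which \<open>2 ^ n\<close> has leading digit \<open>d\<close> is the sum of
  \<open>\<lfloor>n \<alpha> - log 10 d\<rfloor> - \<lfloor>n \<alpha> - log 10 (d + 1)\<rfloor>\<close>; this is
  \<open>benford_error_powers_of_2\<close>.

  The digits 1 and 4 are special because both end points of their intervals are integer multiples of
  \<open>\<alpha>\<close> modulo 1: they are \<open>0\<close> and \<open>\<alpha>\<close> for the digit 1, and \<open>2 \<alpha>\<close> and \<open>log 10 5 = 1 - \<alpha>\<close> for the
  digit 4. Up to an integer constant, the two floors are then values of the same sequence
  \<open>\<lfloor>m \<alpha>\<rfloor>\<close> at indices that differ by 1 and by 3 respectively, so the sum telescopes to one or to three boundary terms.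
  Each boundary term \<open>\<lfloor>m \<alpha>\<rfloor>\<close>, compared with its main term \<open>m \<alpha>\<close>, leaves a fractional part.\<close>

text \<open>Subtracting \<open>w\<close>, with \<open>0 \<le> w \<le> 1\<close>, lowers the floor of \<open>y\<close> by one exactly when \<open>w\<close> exceeds the
  fractional part of \<open>y\<close>.\<close>

lemma of_bool_frac_between:
  fixes y u v :: real
  assumes "0 \<le> u" "u \<le> v" "v \<le> 1"
  shows "of_bool (u \<le> frac y \<and> frac y < v) = \<lfloor>y - u\<rfloor> - \<lfloor>y - v\<rfloor>"
proof -
  have threshold: "\<lfloor>y - w\<rfloor> = \<lfloor>y\<rfloor> - (if w \<le> frac y then 0 else 1)" if "0 \<le> w" "w \<le> 1" for w
    using that by (intro floor_unique) (auto simp: frac_def; linarith)+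
  show ?thesis
    using assms threshold[of u] threshold[of v] by auto
qed

text \<open>Scaling \<open>x\<close> by a power of ten brings it to \<open>10 powr frac (log 10 x)\<close>, a number from 1
  (included) to 10 (excluded) whose integer part is the leading digit.\<close>

lemma leading_digit_eq_iff_frac_log:
  fixes x :: real
  assumes "x > 0" "1 \<le> d" "d \<le> 9"
  shows "leading_digit x = d \<longleftrightarrow> log 10 d \<le> frac (log 10 x) \<and> frac (log 10 x) < log 10 (d + 1)"
proof -
  define t where "t = frac (log 10 x)"
  define m where "m = (10::real) powr t"
  define e where "e = nat \<lfloor>m\<rfloor>"
  have t: "0 \<le> t" "t < 1"
    by (auto simp: t_def frac_lt_1)
  have m: "1 \<le> m" "m < 10"
    using t powr_less_mono[of t 1 10] by (auto simp: m_def ge_one_powr_ge_zero)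
  then have e: "1 \<le> e" "e \<le> 9" "real e \<le> m" "m < real e + 1"
    unfolding e_def by linarith+
  have "x = 10 powr (t + of_int \<lfloor>log 10 x\<rfloor>)"
    using assms by (simp add: t_def frac_def)
  then have x: "x = m * 10 powi \<lfloor>log 10 x\<rfloor>"
    by (simp add: m_def powr_add powr_real_of_int')
  have "real e * 10 powi \<lfloor>log 10 x\<rfloor> \<le> m * 10 powi \<lfloor>log 10 x\<rfloor>"
    "m * 10 powi \<lfloor>log 10 x\<rfloor> < (real e + 1) * 10 powi \<lfloor>log 10 x\<rfloor>"
    using e by (intro mult_right_mono mult_strict_right_mono; simp)+
  then have "leading_digit x = e"
    using e(1,2) unfolding x[symmetric] by (intro leading_digit_eqI)
  moreover have "e = d \<longleftrightarrow> real d \<le> m \<and> m < real d + 1"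
    using e by linarith
  moreover have "real d \<le> m \<longleftrightarrow> log 10 d \<le> t" "m < real d + 1 \<longleftrightarrow> t < log 10 (d + 1)"
    using assms by (simp_all add: m_def log_le_iff less_log_iff add.commute)
  ultimately show ?thesis
    by (simp add: t_def)
qed

lemma benford_error_powers_of_2:
  assumes "1 \<le> d" "d \<le> 9"
  shows "benford_error d N (\<lambda>n. 2 ^ n) =
    of_int (\<Sum>n = 1..N. \<lfloor>real n * log 10 2 - log 10 d\<rfloor> - \<lfloor>real n * log 10 2 - log 10 (d + 1)\<rfloor>)
      - real N * log 10 (1 + 1 / real d)"
proof -
  have "of_bool (leading_digit (2 ^ n) = d) =
      \<lfloor>real n * log 10 2 - log 10 d\<rfloor> - \<lfloor>real n * log 10 2 - log 10 (d + 1)\<rfloor>" for n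
  proof -
    have "0 \<le> log 10 d" "log 10 d \<le> log 10 (d + 1)" "log 10 (d + 1) \<le> 1"
      using assms by auto
    from of_bool_frac_between[OF this, of "real n * log 10 2"] show ?thesis
      using assms by (simp add: leading_digit_eq_iff_frac_log log_nat_power)
  qed
  then have "(\<Sum>n = 1..N. \<lfloor>real n * log 10 2 - log 10 d\<rfloor> - \<lfloor>real n * log 10 2 - log 10 (d + 1)\<rfloor>)
      = (\<Sum>n = 1..N. of_bool (leading_digit (2 ^ n) = d))"
    by (simp only:)
  also have "\<dots> = int (card {n \<in> {1..N}. leading_digit (2 ^ n) = d})"
    by (simp add: Int_def)
  finally show ?thesis
    by (simp only: benford_error_def of_int_of_nat_eq)
qed

theorem theorem3:
  fixes N :: nat and \<alpha> :: real
  assumes "N \<ge> 1" and "\<alpha> = log 10 2"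
  shows "benford_error 1 N (\<lambda>n. 2 ^ n) = - frac (real N * \<alpha>)
    \<and> benford_error 4 N (\<lambda>n. 2 ^ n)
        = frac (real N * \<alpha>) + frac (real N * \<alpha> - \<alpha>) + frac (real N * \<alpha> + \<alpha>) - 1"
proof
  have \<alpha>: "log 10 2 = \<alpha>"
    using assms by simp
  have log4: "log 10 4 = 2 * \<alpha>"
    using log_nat_power[of 2 10 2] \<alpha> by simp
  have log5: "log 10 5 = 1 - \<alpha>"
    using log_mult[of 10 2 5] \<alpha> by simp
  have "(\<Sum>n = 1..N. \<lfloor>real n * \<alpha>\<rfloor> - \<lfloor>real n * \<alpha> - \<alpha>\<rfloor>) = \<lfloor>real N * \<alpha>\<rfloor>"
    by (induction N) (simp_all add: algebra_simps)
  then show "benford_error 1 N (\<lambda>n. 2 ^ n) = - frac (real N * \<alpha>)"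
    by (simp add: benford_error_powers_of_2 \<alpha> frac_def)
  have "0 < \<alpha>" "\<alpha> < 1"
    unfolding assms by simp_all
  then have boundary: "\<lfloor>\<alpha>\<rfloor> = 0" "\<lfloor>- \<alpha>\<rfloor> = - 1"
    by linarith+
  \<comment> \<open>The terms are \<open>1 + \<lfloor>(n - 2) \<alpha>\<rfloor> - \<lfloor>(n + 1) \<alpha>\<rfloor>\<close>, so the floors telescope with step 3;
    the lower boundary \<open>\<lfloor>- \<alpha>\<rfloor> + \<lfloor>0\<rfloor> + \<lfloor>\<alpha>\<rfloor>\<close> is the source of the constant \<open>- 1\<close>.\<close>
  have "(\<Sum>n = 1..N. \<lfloor>real n * \<alpha> - 2 * \<alpha>\<rfloor> - \<lfloor>real n * \<alpha> - (1 - \<alpha>)\<rfloor>)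
      = int N - \<lfloor>real N * \<alpha> - \<alpha>\<rfloor> - \<lfloor>real N * \<alpha>\<rfloor> - \<lfloor>real N * \<alpha> + \<alpha>\<rfloor> - 1"
  proof (induction N)
    case 0
    show ?case by (simp add: boundary)
  next
    case (Suc N)
    have "real (Suc N) * \<alpha> - (1 - \<alpha>) = real (Suc N) * \<alpha> + \<alpha> - 1"
      by simp
    then have "\<lfloor>real (Suc N) * \<alpha> - (1 - \<alpha>)\<rfloor> = \<lfloor>real (Suc N) * \<alpha> + \<alpha>\<rfloor> - 1"
      by (simp only: floor_diff_one)
    moreover have "\<lfloor>real (Suc N) * \<alpha> - 2 * \<alpha>\<rfloor> = \<lfloor>real N * \<alpha> - \<alpha>\<rfloor>"
      "\<lfloor>real (Suc N) * \<alpha> - \<alpha>\<rfloor> = \<lfloor>real N * \<alpha>\<rfloor>" "\<lfloor>real (Suc N) * \<alpha>\<rfloor> = \<lfloor>real N * \<alpha> + \<alpha>\<rfloor>"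
      by (simp_all add: algebra_simps)
    ultimately show ?case
      using Suc.IH by (simp del: of_nat_Suc)
  qed
  moreover have "log 10 (5 / 4) = 1 - 3 * \<alpha>"
    using log_divide[of 10 5 4] log4 log5 by simp
  then have "benford_error 4 N (\<lambda>n. 2 ^ n) =
      of_int (\<Sum>n = 1..N. \<lfloor>real n * \<alpha> - 2 * \<alpha>\<rfloor> - \<lfloor>real n * \<alpha> - (1 - \<alpha>)\<rfloor>)
        - real N * (1 - 3 * \<alpha>)"
    by (simp add: benford_error_powers_of_2 \<alpha> log4 log5)
  ultimately have "benford_error 4 N (\<lambda>n. 2 ^ n) =
      of_int (int N - \<lfloor>real N * \<alpha> - \<alpha>\<rfloor> - \<lfloor>real N * \<alpha>\<rfloor> - \<lfloor>real N * \<alpha> + \<alpha>\<rfloor> - 1)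
        - real N * (1 - 3 * \<alpha>)"
    by (simp only:)
  then show "benford_error 4 N (\<lambda>n. 2 ^ n)
      = frac (real N * \<alpha>) + frac (real N * \<alpha> - \<alpha>) + frac (real N * \<alpha> + \<alpha>) - 1"
    by (simp add: frac_def algebra_simps)
qed

end
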